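(* There exists an absolute constant $C>0$ such that for every finite word $w$ (over any alphabet) of length $n$, \[ \mathrm{RP}(w)\le \frac18 n^2+Cn . \] That is, $\mathrm{RP}(w)\le \frac18 n^2+O(n)$.
   Context: A word is a finite sequence of letters; $\mathrm{Fac}(w)$ is the set of factors (contiguous subwords) of $w$. A rational power is a word of the form $u=p^kp'$, where $p$ is a nonempty word, $k\ge 2$ is an integer, $p^k$ is the concatenation of $k$ copies of $p$, and $p'$ is a prefix of $p$ (possibly empty). $\mathrm{RP}(w)$ denotes the number of distinct factors of $w$ that are rational powers. *)

theory Defs
  imports Complex_Main "HOL-Library.Sublist"
begin

definition Fac :: "'a list \<Rightarrow> 'a list set" where
  "Fac w = {u. sublist u w}"

definition rational_power :: "'a list \<Rightarrow> bool" where
  "rational_power u \<longleftrightarrow>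
     (\<exists>p k p'. p \<noteq> [] \<and> k \<ge> 2 \<and> prefix p' p \<and> u = concat (replicate k p) @ p')"

definition RP :: "'a list \<Rightarrow> nat" where
  "RP w = card {u \<in> Fac w. rational_power u}"

lemma finite_Fac [simp]: "finite (Fac w)"
  unfolding Fac_def set_sublists_eq [symmetric] by simp

end

(* Group the rational powers by the Lyndon word p spelling their shortest period, and let l be the
   length of p. Let x be the number of lengths t > l for which all l conjugates of p^omega
   contribute their prefix of length t as a factor of w. For t <= l + x at most l factors of length t
   belong to p, and beyond l + x every extra letter loses at least one of them, so p contributes at
   most the sum of min(l, r) over r <= x, which is at most x (x + 4 l) / 8 + x / 2.

   If all conjugates occur at length t, then p gives a cycle in the Rauzy graph whose vertices and
   edges are the factors of w of lengths t - 1 and t. The edge starting with p itself lies on no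
   other cycle of at most the same length (Lyndon words are unbordered), so deleting these edges one
   by one keeps the graph connected; hence the number of such p is at most C(t) - C(t-1) + 1, with C
   the factor complexity. Telescoping from t = l + 1 and using C(l) >= l, the values x of all Lyndon
   words of length at least l add up to at most n + 1 - 2 l. With N = n + 1 and these partial sums
   X_1 < X_2 < ... (longest Lyndon words first), x (x + 4 l) is at most
   (N - X_(i-1))^2 - (N - X_i)^2, which telescopes to N^2. *)
theory Submission
  imports Defs "HOL-Library.List_Lexorder"
begin

section \<open>Periods and Lyndon words\<close>

text \<open>The window of length \<open>t\<close> at position \<open>i\<close> of the infinite word
  p p p ...; for \<open>t = length p\<close> it is a conjugate of \<open>p\<close>.\<close>

definition per :: "'a list \<Rightarrow> nat \<Rightarrow> nat \<Rightarrow> 'a list" where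
  "per p i t = map (\<lambda>j. p ! ((i + j) mod length p)) [0..<t]"

definition lyndon :: "'a::linorder list \<Rightarrow> bool" where
  "lyndon p \<longleftrightarrow> p \<noteq> [] \<and> (\<forall>i. 0 < i \<and> i < length p \<longrightarrow> p < rotate i p)"

definition has_period :: "'a list \<Rightarrow> nat \<Rightarrow> bool" where
  "has_period u d \<longleftrightarrow> (\<forall>j. j + d < length u \<longrightarrow> u ! j = u ! (j + d))"

definition full :: "'a list \<Rightarrow> 'a list \<Rightarrow> nat \<Rightarrow> bool" where
  "full w p t \<longleftrightarrow> (\<forall>i < length p. per p i t \<in> Fac w)"

definition factors :: "'a list \<Rightarrow> nat \<Rightarrow> 'a list set" where
  "factors w t = {u \<in> Fac w. length u = t}"

lemma length_per [simp]: "length (per p i t) = t"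
  by (simp add: per_def)

lemma nth_per [simp]: "j < t \<Longrightarrow> per p i t ! j = p ! ((i + j) mod length p)"
  by (simp add: per_def)

lemma per_mod [simp]: "per p (i mod length p) t = per p i t"
  by (simp add: per_def mod_add_left_eq)

lemma butlast_per: "butlast (per p i (Suc t)) = per p i t"
  by (simp add: per_def)

lemma tl_per: "tl (per p i (Suc t)) = per p (Suc i) t"
  by (rule nth_equalityI) (simp_all add: nth_tl)

lemma rotate_eq_per: "rotate i p = per p i (length p)"
  by (rule nth_equalityI) (simp_all add: nth_rotate)

lemma take_per: "s \<le> t \<Longrightarrow> take s (per p i t) = per p i s"
  by (rule nth_equalityI) simp_all

lemma per_0_length [simp]: "per p 0 (length p) = p"
  by (rule nth_equalityI) simp_all

lemma per_rotate: "p \<noteq> [] \<Longrightarrow> per (rotate k p) i t = per p (k + i) t"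
  by (intro nth_equalityI) (simp_all add: nth_rotate mod_add_right_eq add.assoc)

lemma has_period_per: "has_period (per p i t) (length p)"
  unfolding has_period_def
proof (intro allI impI)
  fix j assume "j + length p < length (per p i t)"
  moreover have "(i + (j + length p)) mod length p = (i + j) mod length p"
    by (metis add.assoc mod_add_self2)
  ultimately show "per p i t ! j = per p i t ! (j + length p)" by simp
qed

lemma has_period_eq_per:
  assumes "has_period u d" "0 < d" "d \<le> length u"
  shows "u = per (take d u) 0 (length u)"
proof -
  have mod_d: "u ! j = u ! (j mod d)" if "j < length u" for j
    using that
  proof (induction j rule: less_induct)
    case (less j)
    show ?case
    proof (cases "j < d")
      case False
      then have "u ! (j - d) = u ! j"
        using assms(1) less.prems unfolding has_period_def
        by (metis le_add_diff_inverse2 linorder_not_less)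
      moreover have "u ! (j - d) = u ! ((j - d) mod d)"
        using less False assms(2) by simp
      ultimately show ?thesis using False by (simp add: le_mod_geq)
    qed simp
  qed
  show ?thesis
  proof (rule nth_equalityI)
    fix j assume j: "j < length u"
    show "u ! j = per (take d u) 0 (length u) ! j"
      using assms(2,3) j by (subst mod_d[OF j]) (simp add: min_absorb2)
  qed simp
qed

lemma append_less_append_same: "(b @ x < b @ y) = (x < (y::'a::linorder list))"
  by (induction b) auto

lemma append_less_append_left:
  "length x = length y \<Longrightarrow> (x @ b < y @ b) = (x < (y::'a::linorder list))"
  by (induction x y rule: list_induct2) auto

text \<open>A period \<open>d\<close> gives a border \<open>b\<close>, so p = b x = y b with x and y
  of equal length. Comparing \<open>p\<close> with its rotations b y and x b yields both x < y and y
  < x.\<close>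

lemma lyndon_no_period:
  assumes "lyndon p" "0 < d" "d < length p"
  shows "\<not> has_period p d"
proof
  assume per: "has_period p d"
  let ?l = "length p"
  define b x y where "b = drop d p" and "x = drop (?l - d) p" and "y = take d p"
  have b: "b = take (?l - d) p"
  proof (rule nth_equalityI)
    fix j assume "j < length b"
    then have j: "j + d < ?l" by (simp add: b_def)
    then have "p ! j = p ! (j + d)" using per by (auto simp: has_period_def)
    then show "b ! j = take (?l - d) p ! j" using j by (simp add: b_def add.commute)
  qed (use assms in \<open>simp add: b_def\<close>)
  have pbx: "p = b @ x" unfolding b x_def by simp
  have pyb: "p = y @ b" unfolding b_def y_def by simp
  have "p < rotate d p" "p < rotate (?l - d) p"
    using assms unfolding lyndon_def by auto
  moreover have "rotate d p = b @ y"
    using assms by (simp add: rotate_drop_take b_def y_def)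
  moreover have "rotate (?l - d) p = x @ b"
    using assms unfolding b by (simp add: rotate_drop_take x_def)
  ultimately have "b @ x < b @ y" "y @ b < x @ b"
    using pbx pyb by metis+
  moreover have "length x = length y" using assms by (simp add: x_def y_def)
  ultimately show False
    by (simp add: append_less_append_same append_less_append_left)
qed

lemma lyndon_rotate_eq:
  assumes "lyndon p" "lyndon (rotate i p)"
  shows "rotate i p = p"
proof (rule ccontr)
  assume ne: "rotate i p \<noteq> p"
  define k where "k = i mod length p"
  have pos: "0 < length p" using assms by (auto simp: lyndon_def)
  have ik: "rotate i p = rotate k p" unfolding k_def by (rule rotate_conv_mod)
  have k: "0 < k" "k < length p"
    using ne pos unfolding ik by (auto simp: k_def intro: gr0I)
  have "p < rotate k p" using assms(1) k by (auto simp: lyndon_def)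
  moreover have "rotate k p < rotate (length p - k) (rotate k p)"
    using assms(2) k unfolding ik lyndon_def by auto
  moreover have "rotate (length p - k) (rotate k p) = p"
    using k by (simp add: rotate_rotate)
  ultimately show False by simp
qed

text \<open>The window starts with \<open>p\<close>. If \<open>q\<close> has the same length,
  \<open>p\<close> is a conjugate of \<open>q\<close>; if \<open>q\<close> is shorter,
  \<open>p\<close> inherits the period \<open>length q\<close>, which a Lyndon word cannot have.
  This makes a deleted edge determine its Lyndon word.\<close>

lemma per_lyndon_eq:
  assumes "lyndon p" "lyndon q" "length p \<le> t" "per p 0 t = per q i t"
  shows "length p < length q \<or> p = q"
proof -
  have p: "p = take (length p) (per q i t)"
    using assms(3) by (simp flip: assms(4) add: take_per)
  show ?thesis
  proof (cases "length p" "length q" rule: linorder_cases)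
    case equal
    then have "p = rotate i q"
      using p assms(3) by (simp add: take_per rotate_eq_per)
    then show ?thesis using lyndon_rotate_eq assms by metis
  next
    case greater
    have "has_period p (length q)"
      using has_period_per[of q i "length p"] p assms(3) by (metis take_per)
    then show ?thesis using lyndon_no_period[OF assms(1) _ greater] assms(2) by (auto simp: lyndon_def)
  qed simp
qed

text \<open>Two equal windows would give a nontrivial rotation fixing \<open>p\<close>, but
  \<open>p\<close> is strictly below all of those.\<close>

lemma inj_on_per_lyndon:
  assumes "lyndon p" "length p \<le> t"
  shows "inj_on (\<lambda>i. per p i t) {..<length p}"
proof -
  have *: False if "i < j" "j < length p" "per p i t = per p j t" for i j
  proof -
    have "rotate i p = rotate j p"
      using arg_cong[OF that(3), of "take (length p)"] assms(2) by (simp add: take_per rotate_eq_per)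
    then have "rotate (length p - i) (rotate i p) = rotate (length p - i) (rotate j p)" by simp
    then have "p = rotate (length p - i + j) p" using that by (simp add: rotate_rotate)
    also have "length p - i + j = length p + (j - i)" using that by simp
    also have "rotate (length p + (j - i)) p = rotate (j - i) p"
      by (subst (1 2) rotate_conv_mod) (simp only: mod_add_self1)
    finally have "p = rotate (j - i) p" .
    moreover have "p < rotate (j - i) p" using assms(1) that unfolding lyndon_def by auto
    ultimately show False by simp
  qed
  show ?thesis
    by (rule inj_onI) (metis * lessThan_iff linorder_neqE_nat)
qed

section \<open>Rational powers as windows of periodic Lyndon words\<close>

lemma rational_power_period:
  assumes "rational_power u"
  shows "\<exists>d. 0 < d \<and> 2 * d \<le> length u \<and> has_period u d"
proof -
  obtain p k p' where *: "p \<noteq> []" "2 \<le> k" "prefix p' p" "u = concat (replicate k p) @ p'"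
    using assms unfolding rational_power_def by blast
  obtain k' where k: "k = Suc k'" using *(2) by (cases k) auto
  have comm: "p @ concat (replicate n p) = concat (replicate n p) @ p" for n
    by (induction n) auto
  obtain r where r: "p = p' @ r" using *(3) by (auto simp: prefix_def)
  let ?v = "concat (replicate k' p) @ p'"
  have u1: "u = p @ ?v" by (simp add: * k)
  \<comment> \<open>Appending \<open>r\<close> completes \<open>p'\<close> to \<open>p\<close>, so
    both sides are the power of \<open>p\<close> with exponent k + 1. Hence \<open>?v\<close>, which
    is \<open>u\<close> without its first \<open>p\<close>, is a prefix of
    \<open>u @ r\<close>.\<close>
  have u2: "u @ r = ?v @ r @ p' @ r"
    using comm[of k'] r by (simp add: * k)
  have "has_period u (length p)"
    unfolding has_period_def
  proof (intro allI impI)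
    fix j assume j: "j + length p < length u"
    then have jv: "j < length ?v" by (simp add: u1)
    have "u ! (j + length p) = ?v ! j"
      by (simp add: u1 nth_append)
    also have "\<dots> = (u @ r) ! j"
      using jv by (simp only: u2 nth_append if_True)
    also have "\<dots> = u ! j" using j by (simp add: nth_append)
    finally show "u ! j = u ! (j + length p)" by simp
  qed
  moreover have "length u = k * length p + length p'"
    using * by (simp add: length_concat sum_list_replicate)
  ultimately show ?thesis
    using * by (intro exI[of _ "length p"]) (auto intro: trans_le_add1)
qed

lemma rational_power_lyndon:
  fixes u :: "'a::linorder list"
  assumes "rational_power u"
  shows "\<exists>p i. lyndon p \<and> 2 * length p \<le> length u \<and> i < length p \<and> u = per p i (length u)"
proof -
  define d where "d = (LEAST d. 0 < d \<and> 2 * d \<le> length u \<and> has_period u d)"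
  have d: "0 < d" "2 * d \<le> length u" "has_period u d"
    using LeastI_ex[OF rational_power_period[OF assms]] unfolding d_def by auto
  have dmin: "\<not> has_period u e" if "0 < e" "e < d" for e
    using not_less_Least[OF that(2)[unfolded d_def]] that d by auto
  define q where "q = take d u"
  have q: "length q = d" using d by (simp add: q_def)
  have qne: "q \<noteq> []" using q d by auto
  have u: "u = per q 0 (length u)"
    unfolding q_def using d by (intro has_period_eq_per) auto
  define M where "M = Min ((\<lambda>i. rotate i q) ` {..<d})"
  have fin: "finite ((\<lambda>i. rotate i q) ` {..<d})" by simp
  have "M \<in> (\<lambda>i. rotate i q) ` {..<d}"
    unfolding M_def using d by (intro Min_in) auto
  then obtain i0 where i0: "i0 < d" "M = rotate i0 q" by auto
  have M_le: "M \<le> rotate i q" for i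
  proof -
    have "rotate i q = rotate (i mod d) q" by (subst rotate_conv_mod) (simp only: q)
    then show ?thesis unfolding M_def using d fin by (intro Min_le) auto
  qed
  \<comment> \<open>A rotation fixing \<open>M\<close> also fixes its conjugate \<open>q\<close>,
    and then \<open>u\<close> has the period \<open>i < d\<close>, against the minimality of
    \<open>d\<close>.\<close>
  have ne: "rotate i M \<noteq> M" if "0 < i" "i < d" for i
  proof
    assume "rotate i M = M"
    then have "rotate (d - i0) (rotate i (rotate i0 q)) = rotate (d - i0) (rotate i0 q)"
      by (simp add: i0)
    moreover have "rotate (d - i0) (rotate i0 q) = q" using i0 by (simp add: rotate_rotate q)
    moreover have "rotate (d - i0) (rotate i (rotate i0 q)) = rotate i (rotate (d - i0) (rotate i0 q))"
      by (simp add: rotate_rotate add.left_commute)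
    ultimately have rot: "rotate i q = q" by metis
    have "has_period u i"
      unfolding has_period_def
    proof (intro allI impI)
      fix j assume j: "j + i < length u"
      have "u ! (j + i) = q ! ((j + i) mod d)"
        using u j by (metis add_0 nth_per q)
      also have "\<dots> = rotate i q ! (j mod d)"
        using d by (simp add: nth_rotate q mod_add_right_eq add.commute)
      also have "\<dots> = u ! j" unfolding rot
        using u j by (metis add_0 add_lessD1 nth_per q)
      finally show "u ! j = u ! (j + i)" by simp
    qed
    with dmin that show False by auto
  qed
  have lM: "length M = d" by (simp add: i0 q)
  have "M \<noteq> []" using lM d by auto
  moreover have "M < rotate i M" if "0 < i" "i < d" for i
    using ne[OF that] M_le[of "i + i0"] by (auto simp: i0 rotate_rotate)
  ultimately have "lyndon M" by (auto simp: lyndon_def lM)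
  \<comment> \<open>Starting at \<open>d - i0\<close> undoes the rotation by \<open>i0\<close>;
    reducing modulo \<open>d\<close> matters when \<open>i0 = 0\<close>.\<close>
  moreover have "per M ((d - i0) mod d) (length u) = per q (i0 + (d - i0)) (length u)"
    using per_mod[of M "d - i0"] unfolding lM by (simp only: i0(2) per_rotate[OF qne])
  moreover have "per q (i0 + (d - i0)) (length u) = per q 0 (length u)"
    using i0 per_mod[of q d] by (simp add: q)
  ultimately show ?thesis
    using d u by (intro exI[of _ M] exI[of _ "(d - i0) mod d"]) (auto simp: lM)
qed

section \<open>Cycles in Rauzy graphs\<close>

lemma finite_factors [simp]: "finite (factors w t)"
  by (simp add: factors_def)

lemma factors_eq:
  assumes "t \<le> length w"
  shows "factors w t = (\<lambda>i. take t (drop i w)) ` {..length w - t}"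
proof (intro equalityI subsetI)
  fix u assume "u \<in> factors w t"
  then obtain a b where "w = a @ u @ b" "length u = t"
    by (auto simp: factors_def Fac_def sublist_def)
  then show "u \<in> (\<lambda>i. take t (drop i w)) ` {..length w - t}"
    by (intro image_eqI[of _ _ "length a"]) auto
next
  fix u assume "u \<in> (\<lambda>i. take t (drop i w)) ` {..length w - t}"
  then obtain i where "i \<le> length w - t" "u = take t (drop i w)" by auto
  then show "u \<in> factors w t"
    using assms sublist_order.order_trans[OF sublist_take sublist_drop]
    by (auto simp: factors_def Fac_def)
qed

lemma factors_length: "factors w (length w) = {w}"
  by (simp add: factors_eq)

lemma sublist_Fac: "u \<in> Fac w \<Longrightarrow> sublist v u \<Longrightarrow> v \<in> Fac w"
  by (auto simp: Fac_def intro: sublist_order.order_trans)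

lemma length_Fac: "u \<in> Fac w \<Longrightarrow> length u \<le> length w"
  by (auto simp: Fac_def dest: sublist_length_le)

lemma per_Fac_mono:
  assumes "per p i t \<in> Fac w" "s \<le> t"
  shows "per p i s \<in> Fac w"
  using sublist_Fac[OF assms(1) sublist_take[of s]] assms(2) by (simp add: take_per)

lemma full_mono: "full w p t \<Longrightarrow> s \<le> t \<Longrightarrow> full w p s"
  unfolding full_def using per_Fac_mono by blast

lemma full_length: "full w p t \<Longrightarrow> p \<noteq> [] \<Longrightarrow> t \<le> length w"
  unfolding full_def using length_Fac[of "per p 0 t" w] by simp

lemma full_all: "full w p t \<Longrightarrow> p \<noteq> [] \<Longrightarrow> per p i t \<in> Fac w"
  unfolding full_def using per_mod[of p i t] mod_less_divisor[of "length p" i] by fastforce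

lemma full_Fac: "full w p t \<Longrightarrow> length p \<le> t \<Longrightarrow> p \<noteq> [] \<Longrightarrow> p \<in> Fac w"
  using full_all[OF full_mono, of w p t "length p" 0] by simp

text \<open>A graph with few edges has a potential with many values: identifying the ends of one more
  edge loses at most one value. This replaces counting connected components.\<close>

lemma exists_potential:
  assumes "finite E" "finite V"
  shows "\<exists>c :: 'v \<Rightarrow> 'v. (\<forall>e\<in>E. c (src e) = c (tgt e)) \<and> card V \<le> card (c ` V) + card E"
  using assms(1)
proof (induction E rule: finite_induct)
  case empty
  show ?case by (rule exI[of _ id]) simp
next
  case (insert e E)
  then obtain c :: "'v \<Rightarrow> 'v" where c: "\<forall>e\<in>E. c (src e) = c (tgt e)"
    "card V \<le> card (c ` V) + card E" by blast
  define g where "g z = (if z = c (src e) then c (tgt e) else z)" for z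
  have "c ` V \<subseteq> insert (c (src e)) ((g \<circ> c) ` V)"
    by (auto simp: g_def)
  then have "card (c ` V) \<le> card (insert (c (src e)) ((g \<circ> c) ` V))"
    using assms(2) by (intro card_mono) auto
  also have "\<dots> \<le> Suc (card ((g \<circ> c) ` V))"
    using assms(2) by (simp add: card_insert_if)
  finally have "card V \<le> card ((g \<circ> c) ` V) + card (insert e E)"
    using c(2) insert.hyps by simp
  moreover have "\<forall>e\<in>insert e E. (g \<circ> c) (src e) = (g \<circ> c) (tgt e)"
    using c(1) by (auto simp: g_def)
  ultimately show ?case by blast
qed

text \<open>Choose a potential constant along all edges except one per Lyndon word. Going round the
  cycles shows that it is constant along the deleted edges too, hence constant on all vertices, so
  the surviving edges number at least the vertices minus one.\<close>

lemma card_lyndon_cycles: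
  fixes w :: "'a::linorder list"
  assumes "Suc m \<le> length w"
  defines "L \<equiv> {p. lyndon p \<and> length p \<le> Suc m \<and> full w p (Suc m)}"
  shows "card L + card (factors w m) \<le> card (factors w (Suc m)) + 1"
proof -
  let ?E = "factors w (Suc m)" and ?V = "factors w m"
  let ?e = "\<lambda>p. per p 0 (Suc m)"
  let ?D = "?e ` L"
  have D: "?D \<subseteq> ?E"
    by (auto simp: L_def factors_def lyndon_def intro: full_all)
  have injD: "inj_on ?e L"
  proof (rule inj_onI)
    fix p q assume "p \<in> L" "q \<in> L" "?e p = ?e q"
    then show "p = q"
      using per_lyndon_eq[of p q "Suc m" 0] per_lyndon_eq[of q p "Suc m" 0]
      by (auto simp: L_def)
  qed
  have cardL: "card L = card ?D" by (simp add: card_image injD)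
  obtain c :: "'a list \<Rightarrow> 'a list" where
    c: "\<And>e. e \<in> ?E - ?D \<Longrightarrow> c (butlast e) = c (tl e)"
    and cV: "card ?V \<le> card (c ` ?V) + card (?E - ?D)"
    using exists_potential[of "?E - ?D" ?V butlast tl] by auto
  \<comment> \<open>Another deleted edge on the cycle of p belongs to a shorter Lyndon word, so by induction the
    rest of the cycle carries the potential from the end of the deleted edge to its start.\<close>
  have cD: "c (butlast (?e p)) = c (tl (?e p))" if "p \<in> L" for p
    using that
  proof (induction "length p" arbitrary: p rule: less_induct)
    case less
    let ?l = "length p"
    have p: "lyndon p" "?l \<le> Suc m" "full w p (Suc m)" "p \<noteq> []"
      using less.prems by (auto simp: L_def lyndon_def)
    have step: "c (per p i m) = c (per p (Suc i) m)" if i: "0 < i" "i < ?l" for i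
    proof -
      let ?f = "per p i (Suc m)"
      have "c (butlast ?f) = c (tl ?f)"
      proof (cases "?f \<in> ?D")
        case True
        then obtain q where q: "q \<in> L" "?e q = ?f" by auto
        then have "length q < ?l \<or> q = p"
          using p by (intro per_lyndon_eq[of q p "Suc m" i]) (auto simp: L_def)
        moreover have "q \<noteq> p"
          using inj_onD[OF inj_on_per_lyndon[OF p(1,2)], of 0 i] q(2) i p(4) by auto
        ultimately show ?thesis using less.hyps q by metis
      next
        case False
        then show ?thesis using full_all p by (intro c) (auto simp: factors_def)
      qed
      then show ?thesis by (simp add: butlast_per tl_per)
    qed
    have "c (per p 1 m) = c (per p (Suc i) m)" if "i < ?l" for i
      using that
    proof (induction i)
      case (Suc i)
      then show ?case using step[of "Suc i"] by simp
    qed simp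
    from this[of "?l - 1"] have "c (per p 1 m) = c (per p ?l m)"
      using p by simp
    also have "per p ?l m = per p 0 m" using per_mod[of p ?l m] by simp
    finally show ?case by (simp add: butlast_per tl_per)
  qed
  have cE: "c (butlast e) = c (tl e)" if "e \<in> ?E" for e
    using c cD that by blast
  \<comment> \<open>Reading \<open>w\<close> from left to right is a walk through all
    vertices.\<close>
  have const: "c (take m (drop i w)) = c (take m w)" if "i + m \<le> length w" for i
    using that
  proof (induction i)
    case (Suc i)
    let ?f = "take (Suc m) (drop i w)"
    have "?f \<in> ?E" using Suc.prems assms by (auto simp: factors_eq)
    then have "c (butlast ?f) = c (tl ?f)" by (rule cE)
    moreover have "butlast ?f = take m (drop i w)"
      using Suc.prems by (simp add: butlast_take)
    moreover have "tl ?f = take m (drop (Suc i) w)"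
      by (simp add: tl_take tl_drop drop_Suc)
    ultimately show ?case using Suc by simp
  qed simp
  have "c ` ?V \<subseteq> {c (take m w)}"
    using const assms by (auto simp: factors_eq)
  then have "card (c ` ?V) \<le> 1"
    using card_mono[of "{c (take m w)}"] by simp
  then have "card ?V \<le> 1 + card (?E - ?D)" using cV by linarith
  also have "card (?E - ?D) = card ?E - card ?D"
    using D by (intro card_Diff_subset finite_subset[OF D]) auto
  finally show ?thesis
    using card_mono[OF _ D] cardL by simp
qed

section \<open>Factors belonging to one Lyndon word\<close>

definition starts :: "'a list \<Rightarrow> 'a list \<Rightarrow> nat \<Rightarrow> nat set" where
  "starts w p t = {i. i < length p \<and> per p i t \<in> Fac w}"

text \<open>For nonempty \<open>p\<close> these lengths form an interval starting at
  \<open>length p + 1\<close>, because \<open>full\<close> passes to smaller lengths; so this is the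
  x of the overview.\<close>

definition excess :: "'a list \<Rightarrow> 'a list \<Rightarrow> nat" where
  "excess w p = card {t. length p < t \<and> full w p t}"

lemma starts_subset: "starts w p t \<subseteq> {..<length p}"
  by (auto simp: starts_def)

lemma finite_starts [simp]: "finite (starts w p t)"
  using finite_subset[OF starts_subset] by blast

lemma card_starts_le: "card (starts w p t) \<le> length p"
  using card_mono[OF _ starts_subset] by fastforce

lemma starts_full_iff: "starts w p t = {..<length p} \<longleftrightarrow> full w p t"
  by (auto simp: starts_def full_def)

text \<open>Dropping the last or the first letter sends a start \<open>i\<close> for
  \<open>Suc t\<close> to the starts \<open>i\<close> and i + 1 (mod \<open>length p\<close>) for
  \<open>t\<close>. If no start were lost, the set would be closed under the cyclic successor, hence
  empty or everything.\<close>

lemma card_starts_Suc: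
  assumes "\<not> full w p t"
  shows "card (starts w p (Suc t)) \<le> card (starts w p t) - 1"
proof (cases "starts w p t = {}")
  case True
  then have "starts w p (Suc t) = {}"
    using per_Fac_mono[of p _ "Suc t" w t] by (auto simp: starts_def)
  then show ?thesis by simp
next
  case False
  let ?l = "length p"
  have sub: "starts w p (Suc t) \<subseteq> starts w p t"
    using per_Fac_mono[of p _ "Suc t" w t] by (auto simp: starts_def)
  have next_start: "Suc i mod ?l \<in> starts w p t" if "i \<in> starts w p (Suc t)" for i
  proof -
    have i: "i < ?l" "per p i (Suc t) \<in> Fac w" using that by (auto simp: starts_def)
    have "tl (per p i (Suc t)) \<in> Fac w" by (rule sublist_Fac[OF i(2)]) simp
    moreover have "Suc i mod ?l < ?l" using i(1) by (intro mod_less_divisor) linarith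
    ultimately show ?thesis by (simp add: starts_def tl_per)
  qed
  have "starts w p (Suc t) \<noteq> starts w p t"
  proof
    assume eq: "starts w p (Suc t) = starts w p t"
    obtain i where i: "i \<in> starts w p t" using False by blast
    have all: "(i + k) mod ?l \<in> starts w p t" for k
    proof (induction k)
      case 0
      show ?case using i by (simp add: starts_def)
    next
      case (Suc k)
      then show ?case using next_start[of "(i + k) mod ?l"] eq by (simp add: mod_Suc_eq)
    qed
    have "j \<in> starts w p t" if "j < ?l" for j
    proof -
      have "i < ?l" using i by (simp add: starts_def)
      then have "(i + (?l - i + j)) mod ?l = j" using that by simp
      then show ?thesis using all by metis
    qed
    then have "full w p t" by (auto simp: starts_def full_def)
    with assms show False by simp
  qed
  with sub have "starts w p (Suc t) \<subset> starts w p t" by blast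
  then have "card (starts w p (Suc t)) < card (starts w p t)" by (intro psubset_card_mono) auto
  then show ?thesis by simp
qed

lemma card_starts_not_full:
  assumes "\<not> full w p t"
  shows "card (starts w p (t + j)) \<le> length p - 1 - j"
proof (induction j)
  case 0
  have "starts w p t \<subset> {..<length p}"
    using assms starts_subset[of w p t] starts_full_iff[of w p t] by (simp add: psubset_eq)
  then have "card (starts w p t) < card {..<length p}"
    by (intro psubset_card_mono finite_lessThan)
  then show ?case by simp
next
  case (Suc j)
  have "\<not> full w p (t + j)" using assms full_mono[of w p "t + j" t] by auto
  then show ?case using card_starts_Suc[of w p "t + j"] Suc by simp
qed

lemma finite_full:
  assumes "p \<noteq> []"
  shows "finite {t. length p < t \<and> full w p t}"
  by (rule finite_subset[of _ "{..length w}"]) (use full_length assms in auto)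

text \<open>Otherwise there would be x + 1 full lengths above \<open>length p\<close>, one more than
  \<open>excess\<close> counts.\<close>

lemma not_full_excess:
  assumes "p \<noteq> []"
  shows "\<not> full w p (Suc (length p + excess w p))"
proof
  assume *: "full w p (Suc (length p + excess w p))"
  then have "{length p<..Suc (length p + excess w p)} \<subseteq> {t. length p < t \<and> full w p t}"
    using full_mono by auto
  from card_mono[OF finite_full[OF assms] this] show False
    by (simp flip: excess_def)
qed

lemma card_starts_bound:
  assumes "p \<noteq> []"
  shows "card (starts w p t) \<le> min (length p) (2 * length p + excess w p - t)"
proof (cases "t \<le> length p + excess w p")
  case True
  then show ?thesis using card_starts_le[of w p t] by linarith
next
  case False
  then obtain j where j: "t = Suc (length p + excess w p) + j"
    using not_less_eq_eq le_Suc_ex by metis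
  then show ?thesis
    using card_starts_not_full[OF not_full_excess[OF assms, of w], of j] by auto
qed

section \<open>Closed forms and a uniform bound for the sum of min(l, r)\<close>

lemma sum_min_small: "x \<le> l \<Longrightarrow> 2 * (\<Sum>r\<le>x. min l r) = x * (x + 1)" for l x :: nat
  by (induction x) (simp_all add: algebra_simps)

lemma sum_min_large: "l \<le> x \<Longrightarrow> 2 * (\<Sum>r\<le>x. min l r) + l * l = 2 * (l * x) + l" for l x :: nat
proof (induction x rule: dec_induct)
  case base
  then show ?case using sum_min_small[of l l] by (simp add: algebra_simps)
next
  case (step x)
  then show ?case by (simp add: algebra_simps)
qed

lemma sum_min_bound: "8 * (\<Sum>r\<le>x. min l r) \<le> x * (x + 4 * l) + 4 * x" for l x :: nat
proof (cases "x \<le> l")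
  case True
  \<comment> \<open>Naming the products as variables leaves a linear problem.\<close>
  have arith: "2 * s = b \<Longrightarrow> b = a + x \<Longrightarrow> a \<le> c \<Longrightarrow> d = a + 4 * c \<Longrightarrow> 8 * s \<le> d + 4 * x"
    for s a b c d :: nat by simp
  have "x * x \<le> l * x" using True by (rule mult_right_mono) simp
  then show ?thesis
    by (rule arith[OF sum_min_small[OF True], rotated]) (simp_all add: algebra_simps)
next
  case False
  then have lx: "l \<le> x" by simp
  have arith: "2 * s + e = 2 * c + l \<Longrightarrow> 4 * c \<le> a + 4 * e \<Longrightarrow> d = a + 4 * c \<Longrightarrow> 8 * s \<le> d + 4 * x"
    for s a c d e :: nat using lx by simp
  \<comment> \<open>This is the square of x - 2 l being nonnegative; the quadratic terms of the
    bound are therefore attained at x = 2 l.\<close>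
  have "4 * (l * x) \<le> x * x + 4 * (l * l)"
  proof -
    have "0 \<le> (int x - 2 * int l)\<^sup>2" by simp
    then have "int (4 * (l * x)) \<le> int (x * x + 4 * (l * l))"
      by (simp add: power2_eq_square algebra_simps)
    then show ?thesis by (simp only: of_nat_le_iff)
  qed
  then show ?thesis
    by (rule arith[OF sum_min_large[OF lx]]) (simp add: algebra_simps)
qed

lemma sum_starts_bound:
  assumes "p \<noteq> []"
  shows "8 * (\<Sum>t\<in>{2 * length p..n}. card (starts w p t))
           \<le> excess w p * (excess w p + 4 * length p) + 4 * excess w p"
proof -
  let ?l = "length p" and ?x = "excess w p"
  have "(\<Sum>t\<in>{2 * ?l..n}. card (starts w p t)) \<le> (\<Sum>t\<in>{2 * ?l..n}. min ?l (2 * ?l + ?x - t))"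
    by (intro sum_mono card_starts_bound assms)
  \<comment> \<open>Past 2 l + x the truncated subtraction is 0. The substitution r = 2 l + x - t
    then turns the sum into one over r \<le> x.\<close>
  also have "\<dots> = (\<Sum>t\<in>{2 * ?l..min n (2 * ?l + ?x)}. min ?l (2 * ?l + ?x - t))"
    by (rule sum.mono_neutral_right) auto
  also have "\<dots> \<le> (\<Sum>t\<in>{2 * ?l..2 * ?l + ?x}. min ?l (2 * ?l + ?x - t))"
    by (rule sum_mono2) auto
  also have "\<dots> = (\<Sum>r\<le>?x. min ?l r)"
    by (rule sum.reindex_bij_witness[of _ "\<lambda>r. 2 * ?l + ?x - r" "\<lambda>t. 2 * ?l + ?x - t"]) auto
  finally show ?thesis using sum_min_bound[of ?l ?x] by linarith
qed

section \<open>The quadratic bound\<close>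

lemma card_factors_ge:
  assumes "lyndon p" "full w p t" "length p \<le> t"
  shows "length p \<le> card (factors w (length p))"
proof -
  have "(\<lambda>i. per p i (length p)) ` {..<length p} \<subseteq> factors w (length p)"
    using full_mono[OF assms(2,3)] by (auto simp: factors_def full_def)
  from card_mono[OF _ this] show ?thesis
    using card_image[OF inj_on_per_lyndon[OF assms(1), of "length p"]] by simp
qed

definition heavy :: "'a::linorder list \<Rightarrow> 'a list set" where
  "heavy w = {p. lyndon p \<and> 0 < excess w p}"

lemma heavy_full:
  assumes "p \<in> heavy w"
  shows "lyndon p" "p \<noteq> []" "\<exists>t > length p. full w p t"
proof -
  show "lyndon p" using assms by (simp add: heavy_def)
  then show "p \<noteq> []" by (simp add: lyndon_def)
  show "\<exists>t > length p. full w p t"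
    using assms unfolding heavy_def excess_def by (metis (mono_tags, lifting) card.empty empty_Collect_eq less_irrefl mem_Collect_eq)
qed

lemma finite_heavy [simp]: "finite (heavy w)"
proof (rule finite_subset[OF _ finite_Fac[of w]])
  show "heavy w \<subseteq> Fac w"
    using heavy_full full_Fac[OF _ less_imp_le] by blast
qed

lemma sum_of_bool_card: "finite A \<Longrightarrow> (\<Sum>t\<in>A. of_bool (P t)) = card {t \<in> A. P t}"
  by (simp add: Collect_conj_eq)

text \<open>Double counting of pairs (q, t) with \<open>q\<close> full at \<open>t\<close>: for
  fixed \<open>t\<close>, \<open>card_lyndon_cycles\<close> bounds the number of \<open>q\<close> by
  an increment of the factor complexity plus one.\<close>

lemma sum_excess_bound:
  fixes w :: "'a::linorder list"
  assumes "p \<in> heavy w"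
  shows "(\<Sum>q\<in>{q \<in> heavy w. length p \<le> length q}. excess w q) + 2 * length p \<le> length w + 1"
proof -
  let ?l = "length p" and ?n = "length w"
  let ?S = "{q \<in> heavy w. ?l \<le> length q}"
  let ?L = "\<lambda>t. {q. lyndon q \<and> length q \<le> t \<and> full w q t}"
  obtain t0 where t0: "?l < t0" "full w p t0" and p: "lyndon p" "p \<noteq> []"
    using heavy_full[OF assms] by blast
  then have ln: "?l < ?n" using full_length by fastforce
  have finL: "finite (?L t)" for t
    by (rule finite_subset[OF _ finite_Fac[of w]]) (auto simp: lyndon_def intro: full_Fac)
  have "excess w q = (\<Sum>t\<in>{?l<..?n}. of_bool (length q < t \<and> full w q t))" if "q \<in> ?S" for q
  proof -
    have "q \<noteq> []" using that heavy_full by blast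
    then have "{t. length q < t \<and> full w q t} = {t \<in> {?l<..?n}. length q < t \<and> full w q t}"
      using that full_length[of w q] by auto
    then show ?thesis by (simp only: excess_def sum_of_bool_card[OF finite_greaterThanAtMost])
  qed
  then have "(\<Sum>q\<in>?S. excess w q)
      = (\<Sum>q\<in>?S. \<Sum>t\<in>{?l<..?n}. of_bool (length q < t \<and> full w q t))"
    by (rule sum.cong[OF refl])
  also have "\<dots> = (\<Sum>t\<in>{?l<..?n}. \<Sum>q\<in>?S. of_bool (length q < t \<and> full w q t))"
    by (rule sum.swap)
  also have "\<dots> \<le> (\<Sum>t\<in>{?l<..?n}. card (?L t))"
  proof (rule sum_mono)
    fix t
    have "(\<Sum>q\<in>?S. of_bool (length q < t \<and> full w q t)) = card {q \<in> ?S. length q < t \<and> full w q t}"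
      by (rule sum_of_bool_card) simp
    also have "\<dots> \<le> card (?L t)"
      by (rule card_mono[OF finL]) (use heavy_full in auto)
    finally show "(\<Sum>q\<in>?S. of_bool (length q < t \<and> full w q t)) \<le> card (?L t)" .
  qed
  finally have *: "(\<Sum>q\<in>?S. excess w q) \<le> (\<Sum>t\<in>{?l<..?n}. card (?L t))" .
  have "?l + k \<le> ?n \<Longrightarrow>
      (\<Sum>t\<in>{?l<..?l + k}. card (?L t)) + card (factors w ?l) \<le> card (factors w (?l + k)) + k" for k
  proof (induction k)
    case (Suc k)
    have "{?l<..?l + Suc k} = insert (Suc (?l + k)) {?l<..?l + k}" by auto
    then show ?case
      using Suc card_lyndon_cycles[of "?l + k" w] by simp
  qed simp
  \<comment> \<open>At the top length \<open>w\<close> is its only factor, whence the 1; the second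
    \<open>?l\<close> of the claim comes from the \<open>?l\<close> distinct conjugates of
    \<open>p\<close>.\<close>
  from this[of "?n - ?l"] ln have
    "(\<Sum>t\<in>{?l<..?n}. card (?L t)) + card (factors w ?l) \<le> 1 + (?n - ?l)"
    by (simp add: factors_length)
  moreover have "?l \<le> card (factors w ?l)"
    using card_factors_ge[OF p(1) t0(2)] t0 by simp
  ultimately show ?thesis using * ln by linarith
qed

text \<open>Removing the shortest word p, of length l, reduces to x (x + 4 l) \<le> (N - X)^2 - (N - X - x)^2 for
  the sum X over the other words, which follows from X + x + 2 l \<le> N.\<close>

lemma sum_staircase_bound:
  fixes x l :: "'b \<Rightarrow> nat" and N :: nat
  assumes "finite S" "\<And>p. p \<in> S \<Longrightarrow> (\<Sum>q\<in>{q\<in>S. l p \<le> l q}. x q) + 2 * l p \<le> N"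
  shows "(\<Sum>p\<in>S. int (x p * (x p + 4 * l p))) \<le> (int N)\<^sup>2 - (int N - int (\<Sum>p\<in>S. x p))\<^sup>2"
  using assms
proof (induction "card S" arbitrary: S)
  case (Suc n)
  then have "S \<noteq> {}" by auto
  define p where "p = arg_min_on l S"
  have p: "p \<in> S" "\<And>q. q \<in> S \<Longrightarrow> l p \<le> l q"
    using arg_min_if_finite[OF Suc.prems(1) \<open>S \<noteq> {}\<close>, of l] unfolding p_def by (auto simp: not_less)
  let ?T = "S - {p}"
  let ?X = "\<Sum>q\<in>?T. x q"
  have sumS: "(\<Sum>q\<in>S. f q) = f p + (\<Sum>q\<in>?T. f q)" for f :: "'b \<Rightarrow> int"
    using Suc.prems(1) p(1) by (rule sum.remove)
  have sumN: "(\<Sum>q\<in>S. x q) = x p + ?X" using Suc.prems(1) p(1) by (rule sum.remove)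
  have "{q\<in>S. l p \<le> l q} = S" using p by auto
  then have N: "x p + ?X + 2 * l p \<le> N" using Suc.prems(2)[OF p(1)] sumN by simp
  \<comment> \<open>Deleting \<open>p\<close> only shrinks the partial sums, so the hypothesis
    passes to \<open>?T\<close>.\<close>
  have IH: "(\<Sum>q\<in>?T. int (x q * (x q + 4 * l q))) \<le> (int N)\<^sup>2 - (int N - int ?X)\<^sup>2"
  proof (rule Suc.hyps(1))
    show "n = card ?T" using Suc.hyps(2) Suc.prems(1) p(1) by simp
    fix q assume q: "q \<in> ?T"
    have "(\<Sum>r\<in>{r\<in>?T. l q \<le> l r}. x r) \<le> (\<Sum>r\<in>{r\<in>S. l q \<le> l r}. x r)"
      using Suc.prems(1) by (intro sum_mono2) auto
    then show "(\<Sum>r\<in>{r\<in>?T. l q \<le> l r}. x r) + 2 * l q \<le> N"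
      using Suc.prems(2)[of q] q by simp
  qed (use Suc.prems in simp)
  define a b c where "a = int (x p)" and "b = int ?X" and "c = int (l p)"
  have "int (x p + ?X + 2 * l p) \<le> int N" using N by (rule of_nat_mono)
  then have "a + b + 2 * c \<le> int N"
    unfolding a_def b_def c_def by (simp only: of_nat_add of_nat_mult of_nat_numeral)
  then have "a * (4 * c) \<le> a * (2 * (int N - b - a))"
    by (intro mult_left_mono) (auto simp: a_def)
  then have "a * (a + 4 * c) \<le> (int N - b)\<^sup>2 - (int N - (a + b))\<^sup>2"
    by (simp add: power2_eq_square algebra_simps)
  then show ?case
    using IH unfolding sumS sumN a_def b_def c_def by simp
qed simp

lemma RP_le_sum:
  fixes w :: "'a::linorder list"
  shows "RP w \<le> (\<Sum>p\<in>heavy w. \<Sum>t\<in>{2 * length p..length w}. card (starts w p t))"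
proof -
  let ?U = "\<Union>p\<in>heavy w. \<Union>t\<in>{2 * length p..length w}. (\<lambda>i. per p i t) ` starts w p t"
  have "{u \<in> Fac w. rational_power u} \<subseteq> ?U"
  proof
    fix u assume "u \<in> {u \<in> Fac w. rational_power u}"
    then have u: "u \<in> Fac w" "rational_power u" by auto
    then obtain p i where p: "lyndon p" "2 * length p \<le> length u" "i < length p"
      "u = per p i (length u)"
      using rational_power_lyndon by blast
    have i: "i \<in> starts w p (length u)" using p u by (simp add: starts_def)
    then have "0 < card (starts w p (length u))" using card_gt_0_iff by fastforce
    moreover have "p \<noteq> []" using p by auto
    \<comment> \<open>At length t \<ge> 2 l there are at most 2 l + x - t \<le> x starts, so a
      single one forces x > 0.\<close>
    ultimately have "0 < excess w p"
      using card_starts_bound[of p w "length u"] p(2) by linarith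
    then show "u \<in> ?U"
      using p i length_Fac[OF u(1)] by (auto simp: heavy_def intro!: bexI[of _ p] bexI[of _ "length u"])
  qed
  then have "RP w \<le> card ?U" unfolding RP_def by (rule card_mono[rotated]) auto
  also have "\<dots> \<le> (\<Sum>p\<in>heavy w. card (\<Union>t\<in>{2 * length p..length w}. (\<lambda>i. per p i t) ` starts w p t))"
    by (rule card_UN_le) simp
  also have "\<dots> \<le> (\<Sum>p\<in>heavy w. \<Sum>t\<in>{2 * length p..length w}. card ((\<lambda>i. per p i t) ` starts w p t))"
    by (intro sum_mono card_UN_le) simp
  also have "\<dots> \<le> (\<Sum>p\<in>heavy w. \<Sum>t\<in>{2 * length p..length w}. card (starts w p t))"
    by (intro sum_mono card_image_le) simp
  finally show ?thesis .
qed

text \<open>Controls the linear error terms x / 2: for the shortest heavy word the partial sum is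
  the whole sum.\<close>

lemma sum_excess_le: "(\<Sum>p\<in>heavy w. excess w p) \<le> length w"
proof (cases "heavy w = {}")
  case False
  define p where "p = arg_min_on length (heavy w)"
  have p: "p \<in> heavy w" "\<And>q. q \<in> heavy w \<Longrightarrow> length p \<le> length q"
    using arg_min_if_finite[OF finite_heavy False, of length] unfolding p_def by (auto simp: not_less)
  then have eq: "{q \<in> heavy w. length p \<le> length q} = heavy w" by auto
  have "length p > 0" using heavy_full(2)[OF p(1)] by simp
  then show ?thesis using sum_excess_bound[OF p(1)] unfolding eq by linarith
qed simp

lemma RP_bound:
  fixes w :: "'a::linorder list"
  shows "8 * RP w \<le> (length w + 1)\<^sup>2 + 4 * length w"
proof -
  let ?n = "length w" and ?x = "excess w"
  have "8 * RP w \<le> (\<Sum>p\<in>heavy w. 8 * (\<Sum>t\<in>{2 * length p..?n}. card (starts w p t)))"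
    using RP_le_sum[of w] by (simp flip: sum_distrib_left)
  also have "\<dots> \<le> (\<Sum>p\<in>heavy w. ?x p * (?x p + 4 * length p) + 4 * ?x p)"
    by (intro sum_mono sum_starts_bound heavy_full(2))
  also have "\<dots> = (\<Sum>p\<in>heavy w. ?x p * (?x p + 4 * length p)) + 4 * (\<Sum>p\<in>heavy w. ?x p)"
    by (simp add: sum.distrib sum_distrib_left)
  also have "(\<Sum>p\<in>heavy w. ?x p * (?x p + 4 * length p)) \<le> (?n + 1)\<^sup>2"
  proof -
    have "(\<Sum>p\<in>heavy w. int (?x p * (?x p + 4 * length p)))
        \<le> (int (?n + 1))\<^sup>2 - (int (?n + 1) - int (\<Sum>p\<in>heavy w. ?x p))\<^sup>2"
      by (rule sum_staircase_bound[OF finite_heavy sum_excess_bound])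
    also have "\<dots> \<le> (int (?n + 1))\<^sup>2" by simp
    finally have "int (\<Sum>p\<in>heavy w. ?x p * (?x p + 4 * length p)) \<le> int ((?n + 1)\<^sup>2)"
      by (simp only: of_nat_sum of_nat_power)
    then show ?thesis by (simp only: of_nat_le_iff)
  qed
  finally show ?thesis using sum_excess_le[of w] by linarith
qed

section \<open>Renaming letters and the passage to arbitrary alphabets\<close>

lemma rational_power_map:
  assumes "rational_power u"
  shows "rational_power (map f u)"
proof -
  obtain p k p' where p: "p \<noteq> []" "2 \<le> k" "prefix p' p" and u: "u = concat (replicate k p) @ p'"
    using assms unfolding rational_power_def by blast
  have "map f u = concat (replicate k (map f p)) @ map f p'"
    unfolding u by (simp add: map_concat)
  moreover have "map f p \<noteq> []" "prefix (map f p') (map f p)"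
    using p by (simp_all add: map_mono_prefix)
  ultimately show ?thesis
    using p(2) unfolding rational_power_def by blast
qed

lemma RP_map:
  assumes "inj_on f (set w)"
  shows "RP w \<le> RP (map f w)"
  unfolding RP_def
proof (rule card_inj_on_le)
  show "inj_on (map f) {u \<in> Fac w. rational_power u}"
  proof (rule inj_onI)
    fix u v assume *: "u \<in> {u \<in> Fac w. rational_power u}" "v \<in> {u \<in> Fac w. rational_power u}"
      and eq: "map f u = map f v"
    from * have "set u \<union> set v \<subseteq> set w" using set_mono_sublist[of u w] set_mono_sublist[of v w] by (simp add: Fac_def)
    then show "u = v" by (rule map_inj_on[OF eq inj_on_subset[OF assms]])
  qed
  show "map f ` {u \<in> Fac w. rational_power u} \<subseteq> {u \<in> Fac (map f w). rational_power u}"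
    by (auto simp: Fac_def intro: map_mono_sublist rational_power_map)
  show "finite {u \<in> Fac (map f w). rational_power u}" by simp
qed

(* A constant cannot be quantified outside the letter type 'a, so uniformity over all alphabets
   is expressed in two parts: a constant exists for words over nat, and every constant
   that works for words over nat also works for words over an arbitrary type of letters. *)
theorem theorem10:
  shows "(\<exists>C::real. C > 0 \<and>
            (\<forall>v::nat list. real (RP v) \<le> 1/8 * real (length v) ^ 2 + C * real (length v))) \<and>
         (\<forall>C::real. (\<forall>v::nat list. real (RP v) \<le> 1/8 * real (length v) ^ 2 + C * real (length v)) \<longrightarrow>
            (\<forall>w::'a list. real (RP w) \<le> 1/8 * real (length w) ^ 2 + C * real (length w)))"
proof (intro conjI allI impI)
  \<comment> \<open>C = 1 works: \<open>RP_bound\<close> leaves (6 n + 1) / 8 as lower-order part,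
    at most n once n \<ge> 1. For the empty word it reads 8 RP \<le> 1, forcing 0.\<close>
  have "real (RP v) \<le> 1/8 * real (length v) ^ 2 + 1 * real (length v)" for v :: "nat list"
  proof (cases "v = []")
    case True
    have "RP v = 0" using RP_bound[of v] True by simp
    then show ?thesis by simp
  next
    case False
    have "real (8 * RP v) \<le> real ((length v + 1)\<^sup>2 + 4 * length v)"
      using RP_bound[of v] by (simp only: of_nat_le_iff)
    moreover have "1 \<le> real (length v)" using False by (cases v) auto
    ultimately show ?thesis by (simp add: power2_eq_square algebra_simps)
  qed
  then show "\<exists>C::real. C > 0 \<and>
      (\<forall>v::nat list. real (RP v) \<le> 1/8 * real (length v) ^ 2 + C * real (length v))"
    by (intro exI[of _ 1]) simp
next
  fix C :: real and w :: "'a list"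
  assume C: "\<forall>v::nat list. real (RP v) \<le> 1/8 * real (length v) ^ 2 + C * real (length v)"
  \<comment> \<open>Only the finitely many letters of \<open>w\<close> need distinct codes, so the
    letter type may be uncountable and unordered.\<close>
  obtain f :: "'a \<Rightarrow> nat" where f: "inj_on f (set w)"
    using finite_imp_inj_to_nat_seg[OF finite_set, of w] by auto
  have "real (RP w) \<le> real (RP (map f w))" by (rule of_nat_mono[OF RP_map[OF f]])
  also have "\<dots> \<le> 1/8 * real (length w) ^ 2 + C * real (length w)"
    using C[rule_format, of "map f w"] by simp
  finally show "real (RP w) \<le> 1/8 * real (length w) ^ 2 + C * real (length w)" .
qed

end
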